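(* Let $\mu$ be a Borel probability measure on $\mathbb{C}$ with compact support $S$ for which there are constants $C<\infty$ and $\epsilon>0$ such that $\mu(B(z,r))\le Cr^{\epsilon}$ for all $z\in\mathbb{C}$ and all $r>0$. Let $U_\mu(z)=\int_S\log|z-w|\,d\mu(w)$, and suppose that $U_\mu\ge m$ on $S$ for some $m>0$. Let $X_1,X_2,\dots$ be i.i.d. random variables with distribution $\mu$, let $p_n(z)=\prod_{k=1}^n(z-X_k)$, $\Lambda_n=\{z\in\mathbb{C}:|p_n(z)|<1\}$, and let $\rho_n$ be the inradius of $\Lambda_n$. Then there is a $c_0>0$ such that, with overwhelming probability, $$\Lambda_n\subset\bigcup_{k=1}^nB(X_k,e^{-c_0n})\quad\text{and}\quad \rho_n\le ne^{-c_0n}.$$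
   Context: $B(z,r)$ denotes the disk of center $z$ and radius $r$ in $\mathbb{C}$. The inradius of a set $U\subset\mathbb{C}$ is the supremum of the radii of open disks contained in $U$. A sequence of events $E_n$ holds with overwhelming probability if there is a constant $c>0$ (independent of $n$) such that $\mathbb{P}(E_n)\ge 1-e^{-cn}$ for all sufficiently large $n$. *)

theory Defs
  imports "HOL-Probability.Probability"
begin

definition measure_support :: "complex measure \<Rightarrow> complex set" where
  "measure_support \<mu> = {z. \<forall>r>0. emeasure \<mu> (ball z r) > 0}"

(* Since ln 0 = 0, the integrand is 0 rather than -\<infinity> at w = z. This does not affect the
   integral when \<mu> has no atoms, which the ball-growth condition guarantees; that condition and the
   compactness of the support also make the integral absolutely convergent. *)
definition log_potential :: "complex measure \<Rightarrow> complex \<Rightarrow> real" where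
  "log_potential \<mu> z = (LINT w:measure_support \<mu>|\<mu>. ln (cmod (z - w)))"

definition root_poly :: "(nat \<Rightarrow> complex) \<Rightarrow> nat \<Rightarrow> complex \<Rightarrow> complex" where
  "root_poly x n z = (\<Prod>k=1..n. z - x k)"

definition lemniscate :: "(nat \<Rightarrow> complex) \<Rightarrow> nat \<Rightarrow> complex set" where
  "lemniscate x n = {z. cmod (root_poly x n z) < 1}"

(* The supremum is taken in ennreal, so that it is 0 for a set with empty interior and \<infinity> when
   the radii are unbounded. *)
definition inradius :: "complex set \<Rightarrow> ennreal" where
  "inradius U = Sup {ennreal r |r. r > 0 \<and> (\<exists>z. ball z r \<subseteq> U)}"

definition overwhelming_probability :: "'a measure \<Rightarrow> (nat \<Rightarrow> 'a set) \<Rightarrow> bool" where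
  "overwhelming_probability M E \<longleftrightarrow>
     (\<forall>n. E n \<in> sets M) \<and>
     (\<exists>c>0. \<forall>\<^sub>F n in sequentially. measure M (E n) \<ge> 1 - exp (- c * real n))"

end

theory Submission
  imports Defs "HOL-Complex_Analysis.Complex_Analysis" "HOL-Real_Asymp.Real_Asymp"
begin

text \<open>
  Since \<open>U \<ge> m > 0\<close> on the support \<open>S\<close>, the expansion
  \<open>E |z - X| powr -s = 1 - s U(z) + O(s\<^sup>2)\<close> is uniform over \<open>z \<in> S\<close>, so for small \<open>s > 0\<close> this moment
  is below some \<open>q < 1\<close> on \<open>S\<close> and, by the growth condition, on a neighbourhood of \<open>S\<close>. By
  independence and Markov's inequality \<open>P(|p(g)| < e) \<le> e\<^sup>s q\<^sup>n\<close> for each fixed \<open>g\<close> near \<open>S\<close>, and a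
  union bound extends this to a net of mesh \<open>r\<^sup>2\<close>, where \<open>r = exp (- c\<^sub>0 n)\<close> with \<open>c\<^sub>0\<close> small.
  If \<open>z\<close> near \<open>S\<close> is at distance at least \<open>r\<close> from every root, then passing from \<open>z\<close> to a net point changes
  each factor by a ratio at most \<open>1 + r\<close>, so \<open>|p(z)| \<ge> 1\<close>. Points away from \<open>S\<close>
  are handled by the maximum modulus principle for \<open>1 / p\<close>. The bound on the inradius follows from
  the covering by comparing areas.
\<close>

section \<open>Support and atoms of the measure\<close>

lemma closed_measure_support:
  assumes "sets \<mu> = sets borel"
  shows "closed (measure_support \<mu>)"
proof -
  have "\<exists>e>0. \<forall>w. dist w z < e \<longrightarrow> w \<in> - measure_support \<mu>" if "z \<notin> measure_support \<mu>" for z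
  proof -
    from that obtain r where r: "r > 0" "emeasure \<mu> (ball z r) = 0"
      by (auto simp: measure_support_def)
    have "w \<notin> measure_support \<mu>" if "dist w z < r" for w
    proof -
      have "ball w (r - dist w z) \<subseteq> ball z r"
      proof
        fix v assume "v \<in> ball w (r - dist w z)"
        then show "v \<in> ball z r"
          using dist_triangle[of z v w] by (simp add: dist_commute)
      qed
      then have "emeasure \<mu> (ball w (r - dist w z)) \<le> emeasure \<mu> (ball z r)"
        by (intro emeasure_mono) (simp_all add: assms)
      then show ?thesis
        using r that by (auto simp: measure_support_def intro!: exI[of _ "r - dist w z"])
    qed
    then show ?thesis using r by auto
  qed
  then show ?thesis
    by (simp add: closed_def open_dist)
qed

text \<open>The complement of the support is a union of null balls, and by Lindelof countably many
  of them already cover it.\<close>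

lemma AE_measure_support:
  assumes "sets \<mu> = sets borel"
  shows "AE w in \<mu>. w \<in> measure_support \<mu>"
proof -
  define F where "F = {ball z r |z r. r > 0 \<and> emeasure \<mu> (ball z r) = 0}"
  obtain F' where F': "F' \<subseteq> F" "countable F'" "\<Union>F' = \<Union>F"
    using Lindelof[of F] by (auto simp: F_def)
  have "\<Union>F' \<in> null_sets \<mu>"
  proof -
    have "B \<in> null_sets \<mu>" if "B \<in> F'" for B
      using that F'(1) by (auto simp: F_def null_sets_def assms)
    then show ?thesis
      using null_sets_UN'[OF F'(2), of id \<mu>] by simp
  qed
  moreover have "- measure_support \<mu> \<subseteq> \<Union>F'"
  proof
    fix z assume "z \<in> - measure_support \<mu>"
    then obtain r where "r > 0" "emeasure \<mu> (ball z r) = 0"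
      by (auto simp: measure_support_def)
    then have "ball z r \<in> F" "z \<in> ball z r" by (auto simp: F_def)
    then show "z \<in> \<Union>F'" unfolding F' by blast
  qed
  ultimately show ?thesis
    by (intro AE_I'[of "\<Union>F'"]) auto
qed

text \<open>Let \<open>r\<close> tend to 0 in the growth bound. This matters because
  \<open>0 powr - s = 0\<close>: pointwise comparisons of negative powers can fail at the
  singularity, so that point has to be discarded as a null set.\<close>

lemma AE_not_atom:
  assumes "prob_space \<mu>" "sets \<mu> = sets borel" "\<epsilon> > 0"
    and growth: "\<And>z r. r > 0 \<Longrightarrow> measure \<mu> (ball z r) \<le> C * r powr \<epsilon>"
  shows "AE w in \<mu>. w \<noteq> (z::complex)"
proof -
  interpret prob_space \<mu> by fact
  have "((\<lambda>r. C * r powr \<epsilon>) \<longlongrightarrow> C * 0) (at_right 0)"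
    using \<open>\<epsilon> > 0\<close> by (intro tendsto_mult tendsto_const) real_asymp
  moreover have "eventually (\<lambda>r. measure \<mu> {z} \<le> C * r powr \<epsilon>) (at_right 0)"
    using eventually_at_right_less[of 0]
  proof eventually_elim
    case (elim r)
    have "measure \<mu> {z} \<le> measure \<mu> (ball z r)"
      using elim by (intro finite_measure_mono) (auto simp: assms)
    then show ?case using growth[OF elim, of z] by simp
  qed
  ultimately have "measure \<mu> {z} \<le> C * 0"
    by (rule tendsto_lowerbound) simp
  then have "{z} \<in> null_sets \<mu>"
    by (simp add: null_sets_def assms emeasure_eq_measure measure_le_0_iff)
  then show ?thesis
    by (intro AE_I'[of "{z}"]) auto
qed

section \<open>Negative moments of the distance to a random point\<close>

text \<open>Dyadic decomposition: at distance about \<open>(1/2) ^ j\<close> from \<open>z\<close>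
  the integrand is at most \<open>2 powr (t * (j + 1))\<close>, while the ball of that radius has
  mass at most \<open>C * (1/2) powr (\<epsilon> * j)\<close>. Since \<open>t < \<epsilon>\<close>,
  the products form a convergent geometric series, and nothing in it depends on
  \<open>z\<close>.\<close>

lemma negative_moment_bound:
  assumes "prob_space \<mu>" "sets \<mu> = sets borel" "0 < t" "t < \<epsilon>"
    and growth: "\<And>z r. r > 0 \<Longrightarrow> measure \<mu> (ball z r) \<le> C * r powr \<epsilon>"
  obtains K where "K \<ge> 0" "\<And>z::complex. (\<integral>\<^sup>+ w. ennreal (cmod (z - w) powr - t) \<partial>\<mu>) \<le> ennreal K"
proof -
  interpret prob_space \<mu> by fact
  have [measurable_cong]: "sets \<mu> = sets borel" by fact
  have C: "C \<ge> 0"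
    using growth[of 1 0] measure_nonneg[of \<mu> "ball 0 1"] by (simp del: measure_nonneg)
  define b where "b j = 2 powr (t * (real j + 1)) * (C * (1/2) powr (\<epsilon> * real j))" for j
  define q where "q = (1/2::real) powr (\<epsilon> - t)"
  have b: "b j = 2 powr t * C * q ^ j" for j
  proof -
    have "q ^ j = (1/2) powr (\<epsilon> * real j) * 2 powr (t * real j)"
      unfolding q_def
      by (simp add: powr_power powr_divide powr_diff powr_add ring_distribs left_diff_distrib mult.commute field_simps)
    then show ?thesis
      by (simp add: b_def ring_distribs powr_add)
  qed
  have q: "0 \<le> q" "q < 1"
    using assms(4) powr_less_mono'[of "1/2" 0 "\<epsilon> - t"] by (auto simp: q_def)
  have sb: "summable b" "b j \<ge> 0" for j
    using q C unfolding b by (auto intro!: summable_mult summable_geometric)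
  \<comment> \<open>The summand 1 accounts for the points at distance at least 1, where the
    integrand is at most 1; the series accounts for the punctured unit disk.\<close>
  define K where "K = 1 + (\<Sum>j. b j)"
  have "(\<integral>\<^sup>+ w. ennreal (cmod (z - w) powr - t) \<partial>\<mu>) \<le> ennreal K" for z
  proof -
    define g where
      "g j w = ennreal (2 powr (t * (real j + 1))) * indicator (ball z ((1/2) ^ j)) w" for j :: nat and w
    have [measurable]: "g j \<in> borel_measurable \<mu>" for j
      unfolding g_def
      by (intro borel_measurable_times_ennreal borel_measurable_const borel_measurable_indicator) (simp add: assms(2))
    have pw: "ennreal (cmod (z - w) powr - t) \<le> 1 + (\<Sum>j. g j w)" for w
    proof (cases "cmod (z - w) = 0 \<or> cmod (z - w) \<ge> 1")
      case True
      have "cmod (z - w) powr - t \<le> 1"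
      proof (cases "cmod (z - w) = 0")
        case False
        then have "cmod (z - w) \<ge> 1" using True by auto
        then show ?thesis
          using \<open>0 < t\<close> by (auto simp: powr_minus divide_simps ge_one_powr_ge_zero)
      qed simp
      then have "ennreal (cmod (z - w) powr - t) \<le> 1" by simp
      also have "\<dots> \<le> 1 + (\<Sum>j. g j w)" by simp
      finally show ?thesis .
    next
      case False
      define d where "d = cmod (z - w)"
      have d: "0 < d" "d < 1" using False by (auto simp: d_def)
      \<comment> \<open>This index satisfies \<open>(1/2) ^ (j + 1) \<le> d < (1/2) ^ j\<close>, so
        the single term \<open>g j w\<close> already dominates.\<close>
      define j where "j = nat \<lceil>log (1/2) d\<rceil> - 1"
      have lpos: "log (1/2) d > 0" using d by (simp add: log_less_zero_cancel_iff log_def field_simps ln_div)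
      then have j: "real j < log (1/2) d" "log (1/2) d \<le> real j + 1"
        unfolding j_def by (simp_all add: of_nat_diff nat_ceiling_le_eq) linarith+
      have dl: "d = (1/2) powr log (1/2) d" using d by simp
      have "d < (1/2) powr (real j)"
        using j by (subst dl, intro powr_less_mono') auto
      then have 1: "d < (1/2) ^ j" by (simp add: powr_realpow)
      have 2: "d powr - t \<le> 2 powr (t * (real j + 1))"
      proof -
        have "d powr - t = 2 powr (t * log (1/2) d)"
          using d by (subst dl) (simp add: powr_powr powr_divide powr_minus field_simps powr_one_eq_one)
        also have "\<dots> \<le> 2 powr (t * (real j + 1))"
          using j \<open>0 < t\<close> by (intro powr_mono) auto
        finally show ?thesis .
      qed
      have "ennreal (d powr - t) \<le> g j w"
        using 1 2 by (simp add: g_def d_def dist_norm)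
      also have "\<dots> = (\<Sum>i\<in>{j}. g i w)" by simp
      also have "\<dots> \<le> (\<Sum>j. g j w)" by (rule sum_le_suminf) auto
      also have "\<dots> \<le> 1 + (\<Sum>j. g j w)" by simp
      finally show ?thesis by (simp add: d_def)
    qed
    have "(\<integral>\<^sup>+ w. ennreal (cmod (z - w) powr - t) \<partial>\<mu>) \<le> (\<integral>\<^sup>+ w. 1 + (\<Sum>j. g j w) \<partial>\<mu>)"
      by (intro nn_integral_mono pw)
    also have "\<dots> = 1 + (\<Sum>j. (\<integral>\<^sup>+ w. g j w \<partial>\<mu>))"
      by (subst nn_integral_add) (simp_all add: nn_integral_suminf emeasure_space_1)
    also have "(\<Sum>j. (\<integral>\<^sup>+ w. g j w \<partial>\<mu>)) \<le> (\<Sum>j. ennreal (b j))"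
    proof (intro suminf_le)
      fix j
      have "(\<integral>\<^sup>+ w. g j w \<partial>\<mu>) = ennreal (2 powr (t * (real j + 1)) * measure \<mu> (ball z ((1/2)^j)))"
        unfolding g_def
        by (subst nn_integral_cmult_indicator) (simp_all add: emeasure_eq_measure ennreal_mult assms(2))
      also have "\<dots> \<le> ennreal (b j)"
        using growth[of "(1/2)^j" z] unfolding b_def
        by (intro ennreal_leI mult_left_mono) (auto simp: powr_realpow[symmetric] powr_powr mult.commute)
      finally show "(\<integral>\<^sup>+ w. g j w \<partial>\<mu>) \<le> ennreal (b j)" .
    qed auto
    also have "(\<Sum>j. ennreal (b j)) = ennreal (\<Sum>j. b j)"
      using sb by (intro suminf_ennreal_eq summable_sums) auto
    also have "1 + \<dots> = ennreal K"
      using sb by (simp add: K_def suminf_nonneg flip: ennreal_1 ennreal_plus)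
    finally show ?thesis by simp
  qed
  moreover have "K \<ge> 0"
    using sb by (simp add: K_def suminf_nonneg)
  ultimately show ?thesis using that by blast
qed

text \<open>Taylor expansion with remainder \<open>exp v * x\<^sup>2 / 2\<close>, where
  \<open>x = s * u\<close>. As \<open>x\<^sup>2 = 4 * (s / t)\<^sup>2 * (t * \<bar>u\<bar> /
  2)\<^sup>2\<close>, the quadratic factor and \<open>exp v\<close> are each absorbed by one copy of
  \<open>exp (t * \<bar>u\<bar> / 2)\<close>. The error is thus of order \<open>s\<^sup>2\<close>
  times a quantity that stays integrable for \<open>u = - ln (cmod (z - w))\<close>.\<close>

lemma exp_le_second_order:
  fixes s t u :: real
  assumes "0 < t" "0 \<le> s" "s \<le> t / 2"
  shows "exp (s * u) \<le> 1 + s * u + 4 * (s / t)\<^sup>2 * exp (t * \<bar>u\<bar>)"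
proof -
  define x where "x = s * u"
  obtain v where v: "\<bar>v\<bar> \<le> \<bar>x\<bar>" "exp x = (\<Sum>m<2. x ^ m / fact m) + exp v / fact 2 * x ^ 2"
    using Maclaurin_exp_le[of x 2] by blast
  have ax: "\<bar>x\<bar> \<le> t * \<bar>u\<bar> / 2"
    using assms mult_right_mono[of s "t/2" "\<bar>u\<bar>"] by (simp add: x_def abs_mult)
  have "(t * \<bar>u\<bar> / 2)\<^sup>2 / 2 \<le> exp (t * \<bar>u\<bar> / 2)"
    using exp_lower_Taylor_quadratic[of "t * \<bar>u\<bar> / 2"] assms by (smt (verit) divide_nonneg_nonneg mult_nonneg_nonneg abs_ge_zero)
  moreover have "exp v \<le> exp (t * \<bar>u\<bar> / 2)"
    using v ax by simp
  ultimately have "exp v * ((t * \<bar>u\<bar> / 2)\<^sup>2 / 2) \<le> exp (t * \<bar>u\<bar> / 2) * exp (t * \<bar>u\<bar> / 2)"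
    by (intro mult_mono) auto
  also have "\<dots> = exp (t * \<bar>u\<bar>)" by (simp flip: exp_add)
  finally have "4 * (s / t)\<^sup>2 * (exp v * ((t * \<bar>u\<bar> / 2)\<^sup>2 / 2)) \<le> 4 * (s / t)\<^sup>2 * exp (t * \<bar>u\<bar>)"
    by (intro mult_left_mono) auto
  moreover have "4 * (s / t)\<^sup>2 * (exp v * ((t * \<bar>u\<bar> / 2)\<^sup>2 / 2)) = exp v / fact 2 * x ^ 2"
    using assms by (simp add: x_def power2_eq_square field_simps abs_mult_self)
  ultimately show ?thesis
    using v by (simp add: x_def numeral_2_eq_2)
qed

text \<open>With \<open>u = - ln (cmod (z - w))\<close>, integrating the second-order bound gives at
  most \<open>1 - s * m + c * (K + A)\<close> with \<open>c\<close> of order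
  \<open>s\<^sup>2\<close>; for small \<open>s\<close> the linear gain wins. The condition
  \<open>2 * s < \<epsilon>\<close> is recorded so that the moment of order \<open>2 * s\<close> is
  still finite when the estimate is extended off the support.\<close>

lemma negative_moment_less_one_on_support:
  assumes "prob_space \<mu>" "sets \<mu> = sets borel" "compact (measure_support \<mu>)" "0 < \<epsilon>"
    and growth: "\<And>z r. r > 0 \<Longrightarrow> measure \<mu> (ball z r) \<le> C * r powr \<epsilon>"
    and "0 < m" and pot: "\<And>z. z \<in> measure_support \<mu> \<Longrightarrow> log_potential \<mu> z \<ge> m"
  obtains s q where "0 < s" "2 * s < \<epsilon>" "0 < q" "q < 1"
    "\<And>z. z \<in> measure_support \<mu> \<Longrightarrow> (\<integral>\<^sup>+ w. ennreal (cmod (z - w) powr - s) \<partial>\<mu>) \<le> ennreal q"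
proof -
  interpret prob_space \<mu> by fact
  have [measurable_cong]: "sets \<mu> = sets borel" by fact
  define S where "S = measure_support \<mu>"
  have [measurable]: "S \<in> sets borel"
    using closed_measure_support[OF assms(2)] by (simp add: S_def)
  have AE_S: "AE w in \<mu>. w \<in> S"
    using AE_measure_support[OF assms(2)] by (simp add: S_def)
  obtain R where R: "\<And>w. w \<in> S \<Longrightarrow> cmod w \<le> R"
    using compact_imp_bounded[OF assms(3)] by (auto simp: S_def bounded_iff)
  define t where "t = \<epsilon> / 2"
  have t: "0 < t" "t < \<epsilon>" using \<open>0 < \<epsilon>\<close> by (auto simp: t_def)
  obtain K where K: "K \<ge> 0" "\<And>z. (\<integral>\<^sup>+ w. ennreal (cmod (z - w) powr - t) \<partial>\<mu>) \<le> ennreal K"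
    using negative_moment_bound[OF assms(1,2) t growth] by blast
  \<comment> \<open>Two points of \<open>S\<close> are at distance less than
    \<open>2 * \<bar>R\<bar> + 1\<close>, so \<open>A\<close> bounds
    \<open>exp (t * \<bar>ln d\<bar>) = d powr t\<close> when \<open>d \<ge> 1\<close>; for
    \<open>d < 1\<close> the exponential is \<open>d powr - t\<close>, whose integral is at most
    \<open>K\<close>.\<close>
  define A where "A = (2 * \<bar>R\<bar> + 1) powr t"
  have A: "A > 0" by (simp add: A_def add_nonneg_pos)
  \<comment> \<open>The second entry makes the quadratic error
    \<open>4 * (s / t)\<^sup>2 * (K + A)\<close> at most half of the linear gain
    \<open>s * m\<close>.\<close>
  define s where "s = min (t / 2) (m * t\<^sup>2 / (8 * (K + A)))"
  have s: "0 < s" "s \<le> t / 2" "s \<le> m * t\<^sup>2 / (8 * (K + A))"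
    using t K A \<open>0 < m\<close> unfolding s_def
    by (simp_all only: min.cobounded1 min.cobounded2) simp
  define c where "c = 4 * (s / t)\<^sup>2"
  have "s * (8 * (K + A)) \<le> m * t\<^sup>2"
    using s(3) K A by (simp add: le_divide_eq)
  then have "s * (s * (8 * (K + A))) \<le> s * (m * t\<^sup>2)"
    using s by (intro mult_left_mono) auto
  then have c: "c * (K + A) \<le> s * m / 2" "c \<ge> 0"
    using t by (auto simp: c_def power_divide field_simps power2_eq_square)
  have "(\<integral>\<^sup>+ w. ennreal (cmod (z - w) powr - s) \<partial>\<mu>) \<le> ennreal (exp (- s * m / 2))" if z: "z \<in> S" for z
  proof -
    define L where "L w = indicator S w *\<^sub>R ln (cmod (z - w))" for w
    have U: "log_potential \<mu> z = (\<integral>w. L w \<partial>\<mu>)"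
      by (simp add: log_potential_def set_lebesgue_integral_def L_def S_def)
    have Um: "m \<le> (\<integral>w. L w \<partial>\<mu>)"
      using pot[of z] z U by (simp add: S_def)
    \<comment> \<open>A non-integrable function would have Bochner integral 0.\<close>
    then have L: "integrable \<mu> L"
      using \<open>0 < m\<close> not_integrable_integral_eq[of \<mu> L] by linarith
    have nn: "(\<integral>\<^sup>+ w. ennreal (cmod (z - w) powr - t) \<partial>\<mu>) < \<infinity>"
      using K(2)[of z] by (simp add: le_less_trans)
    then have P: "integrable \<mu> (\<lambda>w. cmod (z - w) powr - t)"
      by (intro integrableI_bounded) auto
    have PK: "(\<integral>w. cmod (z - w) powr - t \<partial>\<mu>) \<le> K"
      using K nn_integral_eq_integral[OF P] by (metis (no_types, lifting) AE_I2 ennreal_le_iff powr_ge_zero)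
    define g where "g w = 1 - s * L w + c * (cmod (z - w) powr - t + A)" for w
    have g: "integrable \<mu> g"
      unfolding g_def using L P by auto
    have le: "AE w in \<mu>. cmod (z - w) powr - s \<le> g w"
      using AE_S
    proof eventually_elim
      case (elim w)
      define d where "d = cmod (z - w)"
      have Lw: "L w = ln d" using elim by (simp add: L_def d_def)
      show ?case
      \<comment> \<open>At \<open>d = 0\<close> both the logarithm and the negative powers take the
        value 0, and the claim reduces to \<open>0 \<le> 1 + c * A\<close>.\<close>
      proof (cases "d = 0")
        case True
        then show ?thesis using c A Lw by (simp add: g_def flip: d_def)
      next
        case False
        then have d: "d > 0" by (simp add: d_def)
        have "d \<le> 2 * \<bar>R\<bar> + 1"
          using R[OF z] R[OF elim] norm_triangle_ineq4[of z w] by (simp add: d_def)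
        have "exp (t * \<bar>- ln d\<bar>) \<le> d powr - t + A"
        proof (cases "d \<ge> 1")
          case True
          then have "exp (t * \<bar>- ln d\<bar>) = d powr t" using d by (simp add: powr_def)
          also have "\<dots> \<le> A" unfolding A_def using \<open>d \<le> _\<close> d t by (intro powr_mono2) auto
          finally show ?thesis by (simp add: add_increasing)
        next
          case False
          then have "exp (t * \<bar>- ln d\<bar>) = d powr - t" using d by (simp add: powr_def)
          then show ?thesis using A by simp
        qed
        have "d powr - s = exp (s * (- ln d))"
          using d by (simp add: powr_def)
        also have "\<dots> \<le> 1 + s * (- ln d) + c * exp (t * \<bar>- ln d\<bar>)"
          unfolding c_def using t s by (intro exp_le_second_order) auto
        also have "\<dots> \<le> 1 + s * (- ln d) + c * (d powr - t + A)"
          using c \<open>exp (t * \<bar>- ln d\<bar>) \<le> _\<close> by (intro add_left_mono mult_left_mono) auto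
        finally show ?thesis by (simp add: g_def Lw d_def)
      qed
    qed
    have "(\<integral>\<^sup>+ w. ennreal (cmod (z - w) powr - s) \<partial>\<mu>) \<le> (\<integral>\<^sup>+ w. ennreal (g w) \<partial>\<mu>)"
      using le by (intro nn_integral_mono_AE) (auto intro: ennreal_leI)
    also have "\<dots> = ennreal (\<integral>w. g w \<partial>\<mu>)"
    proof (intro nn_integral_eq_integral g)
      show "AE w in \<mu>. 0 \<le> g w"
        using le by eventually_elim (auto intro: order_trans[OF powr_ge_zero])
    qed
    also have "(\<integral>w. g w \<partial>\<mu>) = 1 - s * (\<integral>w. L w \<partial>\<mu>) + c * ((\<integral>w. cmod (z - w) powr - t \<partial>\<mu>) + A)"
      unfolding g_def using L P by (simp add: prob_space)
    also have "\<dots> \<le> 1 - s * m + c * (K + A)"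
      using Um PK s c by (intro add_mono diff_mono mult_left_mono) auto
    also have "\<dots> \<le> 1 + (- s * m / 2)" using c by simp
    also have "\<dots> \<le> exp (- s * m / 2)" by (rule exp_ge_add_one_self)
    finally show ?thesis by (simp add: ennreal_leI)
  qed
  moreover have "2 * s < \<epsilon>" using s t by (simp add: t_def)
  moreover have "exp (- s * m / 2) < 1" using s \<open>0 < m\<close> by simp
  ultimately show ?thesis
    using that[of s "exp (- s * m / 2)"] s by (auto simp: S_def)
qed

text \<open>Split at distance \<open>\<delta>\<close> from \<open>z\<close>. Farther out, moving the
  centre to \<open>z0\<close> changes the distance by a ratio at most \<open>1 + h\<close>. Closer
  in, write \<open>d powr - s = d powr s * d powr - (2 * s)\<close> and bound the first factor by
  \<open>\<delta> powr s\<close>.\<close>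

lemma powr_near_comparison:
  fixes z z0 w :: complex
  assumes "dist z z0 \<le> h * \<delta>" "0 < \<delta>" "0 < s" "0 \<le> h" "w \<noteq> z0"
  shows "cmod (z - w) powr - s \<le> (1 + h) powr s * cmod (z0 - w) powr - s + \<delta> powr s * cmod (z - w) powr - (2 * s)"
proof (cases "cmod (z - w) \<ge> \<delta>")
  case True
  have d0: "cmod (z0 - w) > 0" using assms by simp
  have "cmod (z0 - w) \<le> dist z z0 + cmod (z - w)"
    using norm_triangle_ineq[of "z0 - z" "z - w"] by (simp add: dist_norm norm_minus_commute)
  also have "\<dots> \<le> (1 + h) * cmod (z - w)"
    using assms True mult_left_mono[OF True, of h] by (simp add: algebra_simps)
  finally have "cmod (z0 - w) powr s \<le> ((1 + h) * cmod (z - w)) powr s"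
    using assms d0 by (intro powr_mono2) auto
  then have "cmod (z - w) powr - s \<le> (1 + h) powr s * cmod (z0 - w) powr - s"
    using assms True d0 by (simp add: powr_mult powr_minus divide_simps mult.commute del: distrib_right distrib_left)
  then show ?thesis by (simp add: add_increasing2)
next
  case False
  show ?thesis
  proof (cases "z = w")
    case False
    have "cmod (z - w) powr s \<le> \<delta> powr s"
      using assms \<open>\<not> \<delta> \<le> _\<close> by (intro powr_mono2) auto
    then have "cmod (z - w) powr - (2 * s) * cmod (z - w) powr s \<le> cmod (z - w) powr - (2 * s) * \<delta> powr s"
      by (intro mult_left_mono) auto
    also have "cmod (z - w) powr - (2 * s) * cmod (z - w) powr s = cmod (z - w) powr - s"
      using False by (simp flip: powr_add)
    finally show ?thesis by (simp add: add_increasing mult.commute)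
  qed simp
qed

text \<open>Integrate the comparison with \<open>z0\<close> a nearest point of the support. The
  moment of order \<open>2 * s\<close> is bounded uniformly over the whole plane, so its
  contribution vanishes with \<open>\<delta>\<close>, and the other term tends to the bound on the
  support as \<open>h\<close> tends to 0.\<close>

lemma negative_moment_less_one_near_support:
  assumes "prob_space \<mu>" "sets \<mu> = sets borel" "compact (measure_support \<mu>)" "0 < \<epsilon>"
    and growth: "\<And>z r. r > 0 \<Longrightarrow> measure \<mu> (ball z r) \<le> C * r powr \<epsilon>"
    and "0 < m" and pot: "\<And>z. z \<in> measure_support \<mu> \<Longrightarrow> log_potential \<mu> z \<ge> m"
  obtains s q \<eta> where "0 < s" "0 < q" "q < 1" "0 < \<eta>"
    "\<And>z. infdist z (measure_support \<mu>) \<le> \<eta> \<Longrightarrow> (\<integral>\<^sup>+ w. ennreal (cmod (z - w) powr - s) \<partial>\<mu>) \<le> ennreal q"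
proof -
  interpret prob_space \<mu> by fact
  have [measurable_cong]: "sets \<mu> = sets borel" by fact
  have "measure_support \<mu> \<noteq> {}"
    using AE_measure_support[OF assms(2)] by (auto simp: AE_False)
  obtain s q where s: "0 < s" "2 * s < \<epsilon>" and q: "0 < q" "q < 1" and
    on: "\<And>z. z \<in> measure_support \<mu> \<Longrightarrow> (\<integral>\<^sup>+ w. ennreal (cmod (z - w) powr - s) \<partial>\<mu>) \<le> ennreal q"
    using negative_moment_less_one_on_support[OF assms(1-4) growth \<open>0 < m\<close> pot] by metis
  obtain K where K: "K \<ge> 0" "\<And>z. (\<integral>\<^sup>+ w. ennreal (cmod (z - w) powr - (2 * s)) \<partial>\<mu>) \<le> ennreal K"
    using negative_moment_bound[OF assms(1,2) _ s(2) growth] s(1) by auto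
  \<comment> \<open>A third of the gap: each of the two terms of the comparison may lose
    \<open>e\<close>, and \<open>q + 2 * e\<close> is still below 1.\<close>
  define e where "e = (1 - q) / 3"
  have e: "e > 0" using q by (simp add: e_def)
  have "((\<lambda>\<delta>. \<delta> powr s * K) \<longlongrightarrow> 0 * K) (at_right 0)"
    using s by (intro tendsto_mult tendsto_const) real_asymp
  then have "eventually (\<lambda>\<delta>. \<delta> powr s * K < e) (at_right 0)"
    using e by (auto dest: order_tendstoD)
  then have "eventually (\<lambda>\<delta>. \<delta> > 0 \<and> \<delta> powr s * K < e) (at_right 0)"
    using eventually_at_right_less[of 0] by eventually_elim auto
  then obtain \<delta> where \<delta>: "\<delta> > 0" "\<delta> powr s * K < e"
    by (blast dest: eventually_happens'[OF trivial_limit_at_right_real])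
  have "((\<lambda>h. (1 + h) powr s * q) \<longlongrightarrow> (1 + 0) powr s * q) (at_right 0)"
    by (intro tendsto_intros) auto
  then have "eventually (\<lambda>h. (1 + h) powr s * q < q + e) (at_right 0)"
    by (rule order_tendstoD) (use e in simp)
  then have "eventually (\<lambda>h. h > 0 \<and> (1 + h) powr s * q < q + e) (at_right 0)"
    using eventually_at_right_less[of 0] by eventually_elim auto
  then obtain h where h: "h > 0" "(1 + h) powr s * q < q + e"
    by (blast dest: eventually_happens'[OF trivial_limit_at_right_real])
  have "(\<integral>\<^sup>+ w. ennreal (cmod (z - w) powr - s) \<partial>\<mu>) \<le> ennreal (q + 2 * e)"
    if z: "infdist z (measure_support \<mu>) \<le> h * \<delta>" for z
  proof -
    obtain z0 where z0: "z0 \<in> measure_support \<mu>" "dist z z0 \<le> h * \<delta>"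
      using infdist_attains_inf[OF closed_measure_support[OF assms(2)] \<open>_ \<noteq> {}\<close>, of z] z by metis
    have "AE w in \<mu>. w \<noteq> z0"
      by (rule AE_not_atom[OF assms(1,2,4) growth])
    then have "AE w in \<mu>. ennreal (cmod (z - w) powr - s) \<le>
      ennreal ((1 + h) powr s) * ennreal (cmod (z0 - w) powr - s) +
      ennreal (\<delta> powr s) * ennreal (cmod (z - w) powr - (2 * s))"
    proof eventually_elim
      case (elim w)
      show ?case
        using powr_near_comparison[OF z0(2) \<delta>(1) s(1) _ elim] h(1)
        by (simp flip: ennreal_mult ennreal_plus add: ennreal_leI)
    qed
    then have "(\<integral>\<^sup>+ w. ennreal (cmod (z - w) powr - s) \<partial>\<mu>) \<le>
      (\<integral>\<^sup>+ w. ennreal ((1 + h) powr s) * ennreal (cmod (z0 - w) powr - s) +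
        ennreal (\<delta> powr s) * ennreal (cmod (z - w) powr - (2 * s)) \<partial>\<mu>)"
      by (rule nn_integral_mono_AE)
    also have "\<dots> = ennreal ((1 + h) powr s) * (\<integral>\<^sup>+ w. ennreal (cmod (z0 - w) powr - s) \<partial>\<mu>)
      + ennreal (\<delta> powr s) * (\<integral>\<^sup>+ w. ennreal (cmod (z - w) powr - (2 * s)) \<partial>\<mu>)"
      by (simp add: nn_integral_add nn_integral_cmult)
    also have "\<dots> \<le> ennreal ((1 + h) powr s) * ennreal q + ennreal (\<delta> powr s) * ennreal K"
      by (intro add_mono mult_left_mono on K z0) auto
    also have "\<dots> = ennreal ((1 + h) powr s * q + \<delta> powr s * K)"
      using q K by (simp flip: ennreal_mult ennreal_plus)
    also have "\<dots> \<le> ennreal (q + 2 * e)"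
      using \<delta> h by (intro ennreal_leI) auto
    finally show ?thesis .
  qed
  moreover have "q + 2 * e < 1" "0 < q + 2 * e" using q e by (auto simp: e_def field_simps)
  ultimately show ?thesis
    using that[of s "q + 2 * e" "h * \<delta>"] s(1) h(1) \<delta>(1) by auto
qed

section \<open>Root polynomials and the inradius\<close>

lemma cmod_root_poly: "cmod (root_poly x n z) = (\<Prod>k=1..n. cmod (z - x k))"
  by (simp add: root_poly_def prod_norm)

lemma root_poly_measurable [measurable]:
  assumes [measurable]: "\<And>k. k \<in> {1..n} \<Longrightarrow> (\<lambda>\<omega>. x k \<omega>) \<in> borel_measurable M"
  shows "(\<lambda>\<omega>. root_poly (\<lambda>k. x k \<omega>) n z) \<in> borel_measurable M"
  unfolding root_poly_def by measurable

lemma continuous_on_root_poly [continuous_intros]: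
  "continuous_on A f \<Longrightarrow> continuous_on A (\<lambda>z. root_poly x n (f z))"
  unfolding root_poly_def by (intro continuous_intros)

text \<open>Comparing areas gives \<open>R\<^sup>2 \<le> n * r\<^sup>2\<close>, which is then
  weakened using \<open>n \<le> n\<^sup>2\<close>.\<close>

lemma radius_le_of_ball_subset_Union:
  fixes z :: complex and n :: nat
  assumes "ball z R \<subseteq> (\<Union>k\<in>{1..n}. ball (x k) r)" "0 \<le> R" "0 \<le> r"
  shows "R \<le> real n * r"
proof -
  define v where "v = unit_ball_vol (real DIM(complex))"
  have v: "v > 0" by (simp add: v_def)
  have "ennreal (v * R\<^sup>2) = emeasure lborel (ball z R)"
    using assms by (simp add: v_def emeasure_ball)
  also have "\<dots> \<le> emeasure lborel (\<Union>k\<in>{1..n}. ball (x k) r)"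
    using assms by (intro emeasure_mono) auto
  also have "\<dots> \<le> (\<Sum>k\<in>{1..n}. emeasure lborel (ball (x k) r))"
    by (intro emeasure_subadditive_finite) auto
  also have "\<dots> = (\<Sum>k\<in>{1..n}. ennreal (v * r\<^sup>2))"
    using assms by (simp add: v_def emeasure_ball)
  also have "\<dots> = ennreal (\<Sum>k\<in>{1..n}. v * r\<^sup>2)"
    using v by (intro sum_ennreal) auto
  finally have "v * R\<^sup>2 \<le> v * (real n * r\<^sup>2)"
    using v by (subst (asm) ennreal_le_iff) (auto simp: mult_ac)
  then have "R\<^sup>2 \<le> real n * r\<^sup>2"
    using v by simp
  also have "\<dots> \<le> (real n * r)\<^sup>2"
    unfolding power_mult_distrib
    by (intro mult_right_mono) (auto simp: power2_eq_square simp flip: of_nat_mult)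
  finally show ?thesis
    using assms by (simp add: power2_le_iff_abs_le abs_mult)
qed

lemma inradius_le_of_subset_Union:
  assumes "U \<subseteq> (\<Union>k\<in>{1..n}. ball (x k) r)" "0 \<le> r"
  shows "inradius U \<le> ennreal (real n * r)"
  unfolding inradius_def
proof (rule Sup_least)
  fix a assume "a \<in> {ennreal r |r. r > 0 \<and> (\<exists>z. ball z r \<subseteq> U)}"
  then obtain R z where "a = ennreal R" "R > 0" "ball z R \<subseteq> U" by auto
  then show "a \<le> ennreal (real n * r)"
    using radius_le_of_ball_subset_Union[of z R x r n] assms by (auto intro!: ennreal_leI)
qed

section \<open>Measurability of the covering event\<close>

text \<open>An uncovered point of the lemniscate is expressed through countable quantifiers only,
  which makes the event measurable. A fixed \<open>j\<close> turns
  \<open>cmod (root_poly x n z) < 1\<close> into a closed condition on a bounded region; relaxing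
  \<open>r\<close> by \<open>1 / Suc i\<close> leaves room to replace the point by one of
  \<open>D\<close>, and compactness recovers an exact point from all these approximations.\<close>

lemma not_lemniscate_subset_iff:
  fixes D :: "complex set"
  assumes dense: "\<And>U. open U \<Longrightarrow> U \<noteq> {} \<Longrightarrow> \<exists>d\<in>D. d \<in> U"
  shows "\<not> lemniscate x n \<subseteq> (\<Union>k\<in>{1..n}. ball (x k) r) \<longleftrightarrow>
    (\<exists>j::nat. \<forall>i::nat. \<exists>d\<in>D. cmod d \<le> real j \<and> cmod (root_poly x n d) \<le> 1 - 1 / real (Suc j) \<and>
       (\<forall>k\<in>{1..n}. dist (x k) d \<ge> r - 1 / real (Suc i)))" (is "?L \<longleftrightarrow> ?R")
proof
  assume ?L
  then obtain z where "cmod (root_poly x n z) < 1" "\<forall>k\<in>{1..n}. dist (x k) z \<ge> r"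
    by (force simp: lemniscate_def not_less)
  then have z: "cmod (root_poly x n z) < 1" "\<And>k. k \<in> {1..n} \<Longrightarrow> dist (x k) z \<ge> r"
    by auto
  obtain j1 :: nat where j1: "cmod z < real j1" using reals_Archimedean2 by blast
  obtain j2 :: nat where j2: "1 / real (Suc j2) < 1 - cmod (root_poly x n z)"
    using nat_approx_posE[of "1 - cmod (root_poly x n z)"] z by auto
  define j where "j = max j1 j2"
  have "1 / real (Suc j) \<le> 1 / real (Suc j2)"
    by (simp add: j_def frac_le)
  then have j: "cmod z < real j" "cmod (root_poly x n z) < 1 - 1 / real (Suc j)"
    using j1 j2 by (auto simp: j_def)
  show ?R
  proof (intro exI allI)
    fix i :: nat
    define U where "U = {d. cmod d < real j} \<inter> {d. cmod (root_poly x n d) < 1 - 1 / real (Suc j)} \<inter>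
       (\<Inter>k\<in>{1..n}. {d. dist (x k) d > r - 1 / real (Suc i)})"
    have "open U" unfolding U_def
      by (intro open_Int open_INT finite_atLeastAtMost ballI open_Collect_less continuous_intros)
    moreover have "z \<in> U"
      using j z unfolding U_def by (auto intro!: less_le_trans[OF _ z(2)])
    ultimately obtain d where "d \<in> D" "d \<in> U" using dense by blast
    then show "\<exists>d\<in>D. cmod d \<le> real j \<and> cmod (root_poly x n d) \<le> 1 - 1 / real (Suc j) \<and>
       (\<forall>k\<in>{1..n}. dist (x k) d \<ge> r - 1 / real (Suc i))"
      unfolding U_def by (intro bexI[of _ d]) (auto intro: less_imp_le)
  qed
next
  assume ?R
  then obtain j where j: "\<And>i::nat. \<exists>d\<in>D. cmod d \<le> real j \<and> cmod (root_poly x n d) \<le> 1 - 1 / real (Suc j) \<and>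
       (\<forall>k\<in>{1..n}. dist (x k) d \<ge> r - 1 / real (Suc i))" by blast
  define F where "F i = cball 0 (real j) \<inter> ({d. cmod (root_poly x n d) \<le> 1 - 1 / real (Suc j)} \<inter>
       (\<Inter>k\<in>{1..n}. {d. dist (x k) d \<ge> r - 1 / real (Suc i)}))" for i :: nat
  \<comment> \<open>The sets \<open>F i\<close> are compact, nonempty and decreasing; a common point
    satisfies the distance conditions without the relaxation.\<close>
  have "\<Inter>(range F) \<noteq> {}"
  proof (rule compact_nest)
    show "compact (F i)" for i
      unfolding F_def
      by (intro compact_Int_closed compact_cball closed_Int closed_INT ballI closed_Collect_le continuous_intros)
    show "F i \<noteq> {}" for i
      using j[of i] by (auto simp: F_def dist_norm)
    show "F i \<subseteq> F i'" if "i' \<le> i" for i i'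
    proof -
      have "1 / real (Suc i) \<le> 1 / real (Suc i')"
        using that by (simp add: frac_le)
      then show ?thesis by (force simp: F_def)
    qed
  qed
  then obtain z where z: "\<And>i. z \<in> F i" by blast
  have "dist (x k) z \<ge> r" if "k \<in> {1..n}" for k
  proof (rule ccontr)
    assume "\<not> dist (x k) z \<ge> r"
    then obtain i where "1 / real (Suc i) < r - dist (x k) z"
      using nat_approx_posE[of "r - dist (x k) z"] by auto
    then show False using z[of i] that by (force simp: F_def)
  qed
  moreover have "cmod (root_poly x n z) < 1"
    using z[of 0] by (auto simp: F_def intro: le_less_trans)
  ultimately show ?L
    by (force simp: lemniscate_def)
qed

lemma lemniscate_subset_event_measurable:
  assumes X [measurable]: "\<And>k. k \<in> {1..n} \<Longrightarrow> X k \<in> borel_measurable M"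
  shows "{\<omega> \<in> space M. lemniscate (\<lambda>k. X k \<omega>) n \<subseteq> (\<Union>k\<in>{1..n}. ball (X k \<omega>) r)} \<in> sets M"
proof -
  obtain D :: "complex set" where D: "countable D" "\<And>U. open U \<Longrightarrow> U \<noteq> {} \<Longrightarrow> \<exists>d\<in>D. d \<in> U"
    using countable_dense_exists by metis
  define P where "P \<omega> \<longleftrightarrow> (\<exists>j::nat. \<forall>i::nat. \<exists>d\<in>D. cmod d \<le> real j \<and>
       cmod (root_poly (\<lambda>k. X k \<omega>) n d) \<le> 1 - 1 / real (Suc j) \<and>
       (\<forall>k\<in>{1..n}. dist (X k \<omega>) d \<ge> r - 1 / real (Suc i)))" for \<omega>
  have P: "lemniscate (\<lambda>k. X k \<omega>) n \<subseteq> (\<Union>k\<in>{1..n}. ball (X k \<omega>) r) \<longleftrightarrow> \<not> P \<omega>" for \<omega>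
    using not_lemniscate_subset_iff[OF D(2), of "\<lambda>k. X k \<omega>" n r] unfolding P_def by blast
  have [measurable]: "X k \<in> borel_measurable M" if "k \<in> {1..n}" for k using that by (rule X)
  have "Measurable.pred M (\<lambda>\<omega>. \<not> P \<omega>)"
    unfolding P_def using D(1) by measurable
  then show ?thesis
    unfolding P pred_def .
qed

section \<open>Deterministic covering from lower bounds on a net\<close>

text \<open>The mesh is \<open>r\<^sup>2\<close> because then
  \<open>dist z g \<le> r * cmod (z - x k)\<close> for every root, so each factor grows by a ratio
  at most \<open>1 + r \<le> exp r\<close>.\<close>

lemma root_poly_net_comparison:
  assumes far: "\<And>k. k \<in> {1..n} \<Longrightarrow> r \<le> dist (x k) z" and "dist z g \<le> r\<^sup>2" "0 < r"
  shows "cmod (root_poly x n g) \<le> exp (real n * r) * cmod (root_poly x n z)"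
proof -
  have "cmod (g - x k) \<le> exp r * cmod (z - x k)" if "k \<in> {1..n}" for k
  proof -
    have "cmod (g - x k) \<le> dist z g + cmod (z - x k)"
      using norm_triangle_ineq[of "g - z" "z - x k"] by (simp add: dist_norm norm_minus_commute)
    also have "dist z g \<le> r * cmod (z - x k)"
      using order_trans[OF assms(2)[unfolded power2_eq_square] mult_left_mono[OF far[OF that]]] \<open>0 < r\<close>
      by (simp add: dist_norm norm_minus_commute)
    also have "r * cmod (z - x k) + cmod (z - x k) = (1 + r) * cmod (z - x k)"
      by (simp add: algebra_simps)
    also have "\<dots> \<le> exp r * cmod (z - x k)"
      by (intro mult_right_mono exp_ge_add_one_self) auto
    finally show ?thesis by simp
  qed
  then have "cmod (root_poly x n g) \<le> (\<Prod>k=1..n. exp r * cmod (z - x k))"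
    unfolding cmod_root_poly by (intro prod_mono) auto
  also have "\<dots> = exp (real n * r) * cmod (root_poly x n z)"
    by (simp add: prod.distrib cmod_root_poly exp_of_nat_mult)
  finally show ?thesis .
qed

text \<open>Three regions are treated: near \<open>S\<close> the net controls the polynomial away
  from the roots, beyond radius \<open>R + 1\<close> every factor is at least 1, and in between the
  maximum modulus principle for the reciprocal transfers the bound from the boundary.\<close>

lemma lemniscate_subset_of_net:
  fixes S :: "complex set"
  assumes S: "S \<subseteq> cball 0 R"
    and x: "\<And>k. k \<in> {1..n} \<Longrightarrow> x k \<in> S"
    and r: "0 < r" "r < 1" "r \<le> \<eta>" "r\<^sup>2 \<le> \<eta>" "real n * r \<le> 1"
    and net: "\<And>z. cmod z \<le> R + 1 \<Longrightarrow> \<exists>g\<in>G. dist z g \<le> r\<^sup>2"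
    and large: "\<And>g. g \<in> G \<Longrightarrow> infdist g S \<le> 2 * \<eta> \<Longrightarrow> root_poly x n g \<noteq> 0 \<Longrightarrow> exp 1 \<le> cmod (root_poly x n g)"
  shows "lemniscate x n \<subseteq> (\<Union>k\<in>{1..n}. ball (x k) r)"
proof -
  have near: "1 \<le> cmod (root_poly x n z)"
    if z: "cmod z \<le> R + 1" "infdist z S \<le> \<eta>" and far: "\<And>k. k \<in> {1..n} \<Longrightarrow> r \<le> dist (x k) z" for z
  proof -
    obtain g where g: "g \<in> G" "dist z g \<le> r\<^sup>2" using net z by blast
    have "infdist g S \<le> infdist z S + dist g z"
      by (rule infdist_triangle)
    then have *: "infdist g S \<le> 2 * \<eta>" using z g r by (simp add: dist_commute)
    \<comment> \<open>\<open>z\<close> is at distance at least \<open>r\<close> from the roots but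
      at most \<open>r\<^sup>2 < r\<close> from \<open>g\<close>. This supplies the nonvanishing
      that \<open>large\<close> demands.\<close>
    have "g \<noteq> x k" if k: "k \<in> {1..n}" for k
    proof
      assume "g = x k"
      then have "r \<le> r * r" using far[OF k] g by (simp add: power2_eq_square dist_commute)
      then show False using r by simp
    qed
    then have "root_poly x n g \<noteq> 0" by (auto simp: root_poly_def)
    then have "exp 1 \<le> cmod (root_poly x n g)"
      using large g * by blast
    also have "\<dots> \<le> exp (real n * r) * cmod (root_poly x n z)"
      using far g r by (intro root_poly_net_comparison) auto
    also have "\<dots> \<le> exp 1 * cmod (root_poly x n z)"
      using r by (intro mult_right_mono) auto
    finally show ?thesis by simp
  qed
  have outside: "1 \<le> cmod (root_poly x n z)" if z: "cmod z \<ge> R + 1" for z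
    unfolding cmod_root_poly
  proof (rule prod_ge_1)
    fix k assume "k \<in> {1..n}"
    then have "cmod (x k) \<le> R" using x S by force
    then show "1 \<le> cmod (z - x k)" using z norm_triangle_ineq2[of z "x k"] by linarith
  qed
  have sep: "\<eta> \<le> dist (x k) z" if "k \<in> {1..n}" "infdist z S \<ge> \<eta>" for k z
    using infdist_le[OF x[OF that(1)], of z] that by (simp add: dist_commute)
  have pos: "1 \<le> cmod (root_poly x n z)" if z: "infdist z S > \<eta>" for z
  proof (cases "cmod z < R + 1")
    case False
    then show ?thesis using outside by simp
  next
    case True
    \<comment> \<open>All roots lie in \<open>S\<close>, so the reciprocal is holomorphic on
      \<open>D\<close>. A frontier point has modulus \<open>R + 1\<close>, where
      \<open>outside\<close> applies, or distance exactly \<open>\<eta>\<close> from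
      \<open>S\<close>, where \<open>near\<close> applies because the roots are at distance at least
      \<open>\<eta> \<ge> r\<close>.\<close>
    define D where "D = {w. cmod w < R + 1} \<inter> {w. \<eta> < infdist w S}"
    define E where "E = {w. cmod w \<le> R + 1} \<inter> {w. \<eta> \<le> infdist w S}"
    have "open D"
      unfolding D_def by (intro open_Int open_Collect_less continuous_intros)
    have "closed E"
      unfolding E_def by (intro closed_Int closed_Collect_le continuous_intros)
    then have cl: "closure D \<subseteq> E"
      by (intro closure_minimal) (auto simp: D_def E_def)
    have nz: "root_poly x n w \<noteq> 0" if "w \<in> E" for w
    proof -
      have "w \<noteq> x k" if "k \<in> {1..n}" for k
        using sep[OF that, of w] \<open>w \<in> E\<close> r by (auto simp: E_def)
      then show ?thesis by (auto simp: root_poly_def)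
    qed
    have "cmod (1 / root_poly x n z) \<le> 1"
    proof (rule maximum_modulus_frontier[of "\<lambda>z. 1 / root_poly x n z" D])
      show "(\<lambda>z. 1 / root_poly x n z) holomorphic_on interior D"
        using nz cl interior_subset[of D] closure_subset[of D] unfolding root_poly_def
        by (intro holomorphic_intros) blast
      show "continuous_on (closure D) (\<lambda>z. 1 / root_poly x n z)"
        using nz cl by (intro continuous_intros) blast
      show "bounded D"
        by (rule bounded_subset[of "ball 0 (R + 1)"]) (auto simp: D_def)
      show "z \<in> D"
        using True z by (simp add: D_def)
      show "cmod (1 / root_poly x n w) \<le> 1" if "w \<in> frontier D" for w
      proof -
        have "w \<in> E" "w \<notin> D"
          using that cl \<open>open D\<close> by (auto simp: frontier_def interior_open)
        then consider "cmod w = R + 1" | "cmod w \<le> R + 1" "infdist w S = \<eta>"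
          by (fastforce simp: D_def E_def)
        then have "1 \<le> cmod (root_poly x n w)"
        proof cases
          case 2
          then show ?thesis using r by (intro near) (auto intro: order_trans[OF _ sep])
        qed (simp add: outside)
        then show ?thesis by (simp add: norm_divide divide_simps)
      qed
    qed
    moreover have "root_poly x n z \<noteq> 0"
      using True z by (intro nz) (simp add: E_def)
    ultimately show ?thesis
      by (simp add: norm_divide divide_simps)
  qed
  show ?thesis
  proof
    fix z assume "z \<in> lemniscate x n"
    then have lt: "cmod (root_poly x n z) < 1" by (simp add: lemniscate_def)
    then have "cmod z \<le> R + 1" "infdist z S \<le> \<eta>"
      using outside[of z] pos[of z] by linarith+
    then have "\<not> (\<forall>k\<in>{1..n}. r \<le> dist (x k) z)"
      using near[of z] lt by fastforce
    then show "z \<in> (\<Union>k\<in>{1..n}. ball (x k) r)"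
      by (simp add: not_le)
  qed
qed

section \<open>Small values at a fixed point, and the size of a net\<close>

text \<open>Markov's inequality for
  \<open>cmod (root_poly (\<lambda>k. X k \<omega>) n z) powr - s\<close>, whose expectation
  factorises by independence. The event excludes a vanishing polynomial because
  \<open>0 powr - s = 0\<close>, so Markov's inequality would not detect it.\<close>

lemma root_poly_small_probability:
  fixes X :: "nat \<Rightarrow> 'a \<Rightarrow> complex"
  assumes "prob_space M" and indep: "prob_space.indep_vars M (\<lambda>_. borel) X {1..}"
    and distr: "\<And>k. k \<ge> 1 \<Longrightarrow> distr M borel (X k) = \<mu>"
    and "0 < s" "0 \<le> q" and q: "(\<integral>\<^sup>+ w. ennreal (cmod (z - w) powr - s) \<partial>\<mu>) \<le> ennreal q"
  shows "emeasure M {\<omega> \<in> space M. root_poly (\<lambda>k. X k \<omega>) n z \<noteq> 0 \<and> cmod (root_poly (\<lambda>k. X k \<omega>) n z) < exp 1}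
    \<le> ennreal (exp s * q ^ n)"
proof -
  interpret prob_space M by fact
  have X [measurable]: "X k \<in> borel_measurable M" if "k \<ge> 1" for k
    using indep that unfolding indep_vars_def by auto
  define Y where "Y k \<omega> = ennreal (cmod (z - X k \<omega>) powr - s)" for k \<omega>
  have Y [measurable]: "Y k \<in> borel_measurable M" if "k \<ge> 1" for k
    unfolding Y_def using X[OF that] by measurable
  have indY: "indep_vars (\<lambda>_. borel) Y {1..n}"
    unfolding Y_def
    by (rule indep_vars_compose2[OF indep_vars_subset[OF indep], where Y="\<lambda>_ w. ennreal (cmod (z - w) powr - s)"]) auto
  have "(\<integral>\<^sup>+ \<omega>. (\<Prod>k\<in>{1..n}. Y k \<omega>) \<partial>M) = (\<Prod>k\<in>{1..n}. (\<integral>\<^sup>+ \<omega>. Y k \<omega> \<partial>M))"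
    using indY by (intro indep_vars_nn_integral) auto
  also have "\<dots> \<le> (\<Prod>k\<in>{1..n}. ennreal q)"
  proof (rule prod_mono_ennreal)
    fix k assume k: "k \<in> {1..n}"
    have "(\<integral>\<^sup>+ \<omega>. Y k \<omega> \<partial>M) = (\<integral>\<^sup>+ w. ennreal (cmod (z - w) powr - s) \<partial>distr M borel (X k))"
      unfolding Y_def using X k by (subst nn_integral_distr) auto
    then show "(\<integral>\<^sup>+ \<omega>. Y k \<omega> \<partial>M) \<le> ennreal q"
      using distr[of k] q k by simp
  qed
  finally have prod: "(\<integral>\<^sup>+ \<omega>. (\<Prod>k\<in>{1..n}. Y k \<omega>) \<partial>M) \<le> ennreal (q ^ n)"
    using \<open>0 \<le> q\<close> by (simp add: ennreal_power)
  have "1 \<le> ennreal (exp s) * (\<Prod>k\<in>{1..n}. Y k \<omega>)"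
    if "root_poly (\<lambda>k. X k \<omega>) n z \<noteq> 0" "cmod (root_poly (\<lambda>k. X k \<omega>) n z) < exp 1" for \<omega>
  proof -
    define P where "P = cmod (root_poly (\<lambda>k. X k \<omega>) n z)"
    have P: "0 < P" "P < exp 1" using that by (auto simp: P_def)
    have "(\<Prod>k\<in>{1..n}. Y k \<omega>) = ennreal (P powr - s)"
      by (simp add: Y_def P_def cmod_root_poly prod_ennreal prod_powr_distrib)
    moreover have "s * ln P \<le> s * ln (exp 1)"
      using P \<open>0 < s\<close> by (intro mult_left_mono) (auto simp del: ln_exp)
    then have "1 \<le> exp s * P powr - s"
      using P by (simp add: powr_def flip: exp_add)
    ultimately show ?thesis
      by (simp flip: ennreal_mult ennreal_1)
  qed
  then have "emeasure M {\<omega> \<in> space M. root_poly (\<lambda>k. X k \<omega>) n z \<noteq> 0 \<and> cmod (root_poly (\<lambda>k. X k \<omega>) n z) < exp 1}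
     \<le> emeasure M {\<omega> \<in> space M. 1 \<le> ennreal (exp s) * (\<Prod>k\<in>{1..n}. Y k \<omega>)}"
    by (intro emeasure_mono) auto
  also have "\<dots> \<le> ennreal (exp s) * (\<integral>\<^sup>+ \<omega>. (\<Prod>k\<in>{1..n}. Y k \<omega>) * indicator (space M) \<omega> \<partial>M)"
    by (intro nn_integral_Markov_inequality) auto
  also have "\<dots> = ennreal (exp s) * (\<integral>\<^sup>+ \<omega>. (\<Prod>k\<in>{1..n}. Y k \<omega>) \<partial>M)"
    by (intro arg_cong[where f="\<lambda>u. ennreal (exp s) * u"] nn_integral_cong) auto
  also have "\<dots> \<le> ennreal (exp s) * ennreal (q ^ n)"
    by (intro mult_left_mono prod) auto
  finally show ?thesis
    using \<open>0 \<le> q\<close> by (simp add: ennreal_mult)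
qed

text \<open>The net is a square lattice of spacing \<open>h\<close>; rounding down costs at most
  \<open>h\<close> in each coordinate.\<close>

lemma finite_net_cball:
  fixes T h :: real
  assumes "0 < h" "h \<le> 1" "1 \<le> T"
  obtains G :: "complex set" where "finite G" "real (card G) \<le> (8 * T / h)\<^sup>2"
    "\<And>z. cmod z \<le> T \<Longrightarrow> \<exists>g\<in>G. dist z g \<le> 2 * h"
proof -
  define N where "N = \<lceil>T / h\<rceil>"
  define G where "G = (\<lambda>(a, b). Complex (of_int a * h) (of_int b * h)) ` ({-N..N} \<times> {-N..N})"
  have Th: "T / h \<ge> 1" using assms by (simp add: le_divide_eq)
  have N: "of_int N \<le> T / h + 1" "T / h \<le> of_int N" unfolding N_def by linarith+
  have "N \<ge> 1" using N(2) Th by linarith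
  have "card G \<le> card ({-N..N} \<times> {-N..N})"
    unfolding G_def by (intro card_image_le) auto
  also have "\<dots> = (nat (2 * N + 1))\<^sup>2"
    by (simp add: card_cartesian_product power2_eq_square)
  finally have "real (card G) \<le> (real (nat (2 * N + 1)))\<^sup>2"
    by (metis of_nat_le_iff of_nat_power)
  \<comment> \<open>Since \<open>T / h \<ge> 1\<close>, the side \<open>2 * N + 1\<close> is at most
    \<open>2 * T / h + 3 \<le> 5 * T / h\<close>; the constant 8 leaves slack.\<close>
  also have "\<dots> \<le> (8 * T / h)\<^sup>2"
  proof (intro power_mono)
    have "real (nat (2 * N + 1)) \<le> 8 * (T / h)"
      using N(1) Th \<open>N \<ge> 1\<close> by simp
    then show "real (nat (2 * N + 1)) \<le> 8 * T / h" by simp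
  qed simp
  finally have card: "real (card G) \<le> (8 * T / h)\<^sup>2" .
  have net: "\<exists>g\<in>G. dist z g \<le> 2 * h" if z: "cmod z \<le> T" for z
  proof -
    have coord: "\<lfloor>u / h\<rfloor> \<in> {-N..N} \<and> \<bar>u - of_int \<lfloor>u / h\<rfloor> * h\<bar> \<le> h" if "\<bar>u\<bar> \<le> T" for u
    proof
      have "u / h \<le> T / h" "- (T / h) \<le> u / h"
        using that assms by (auto simp: divide_simps)
      then show "\<lfloor>u / h\<rfloor> \<in> {-N..N}"
        using N(2) by (auto simp: le_floor_iff floor_le_iff)
      have "of_int \<lfloor>u / h\<rfloor> * h \<le> u / h * h" "u / h * h \<le> (of_int \<lfloor>u / h\<rfloor> + 1) * h"
        using assms by (intro mult_right_mono; linarith)+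
      then show "\<bar>u - of_int \<lfloor>u / h\<rfloor> * h\<bar> \<le> h"
        using assms by (simp add: algebra_simps)
    qed
    define g where "g = Complex (of_int \<lfloor>Re z / h\<rfloor> * h) (of_int \<lfloor>Im z / h\<rfloor> * h)"
    have "\<bar>Re z\<bar> \<le> T" "\<bar>Im z\<bar> \<le> T"
      using z abs_Re_le_cmod[of z] abs_Im_le_cmod[of z] by auto
    note c = this[THEN coord]
    have "g \<in> G" unfolding G_def g_def using c
      by (intro image_eqI[of _ _ "(\<lfloor>Re z / h\<rfloor>, \<lfloor>Im z / h\<rfloor>)"]) auto
    moreover have "dist z g \<le> 2 * h"
      using cmod_le[of "z - g"] c by (simp add: g_def dist_norm)
    ultimately show ?thesis by blast
  qed
  have "finite G" by (simp add: G_def)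
  then show ?thesis using that card net by blast
qed

section \<open>Union bound and conclusion\<close>

theorem corollary1p4:
  fixes \<mu> :: "complex measure"
    and M :: "'a measure"
    and X :: "nat \<Rightarrow> 'a \<Rightarrow> complex"
    and C \<epsilon> m :: real
  assumes "prob_space \<mu>" and "sets \<mu> = sets borel"
    and "compact (measure_support \<mu>)"
    and "\<epsilon> > 0"
    and "\<And>z r. r > 0 \<Longrightarrow> measure \<mu> (ball z r) \<le> C * r powr \<epsilon>"
    and "m > 0"
    and "\<And>z. z \<in> measure_support \<mu> \<Longrightarrow> log_potential \<mu> z \<ge> m"
    and "prob_space M"
    and "prob_space.indep_vars M (\<lambda>_. borel) X {1..}"
    and "\<And>k. k \<ge> 1 \<Longrightarrow> distr M borel (X k) = \<mu>"
  shows "\<exists>c\<^sub>0>0. overwhelming_probability M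
           (\<lambda>n. {\<omega> \<in> space M.
              lemniscate (\<lambda>k. X k \<omega>) n \<subseteq> (\<Union>k\<in>{1..n}. ball (X k \<omega>) (exp (- c\<^sub>0 * real n))) \<and>
              inradius (lemniscate (\<lambda>k. X k \<omega>) n) \<le> ennreal (real n * exp (- c\<^sub>0 * real n))})"
proof -
  interpret prob_space M by fact
  define S where "S = measure_support \<mu>"
  have X [measurable]: "X k \<in> borel_measurable M" if "k \<ge> 1" for k
    using assms(9) that unfolding indep_vars_def by auto
  have AE_S: "AE \<omega> in M. \<forall>k\<in>{1..}. X k \<omega> \<in> S"
  proof (subst AE_ball_countable; intro countableI_type ballI)
    fix k :: nat assume "k \<in> {1..}"
    then have "AE w in distr M borel (X k). w \<in> S"
      using AE_measure_support[OF assms(2)] by (subst assms(10)) (auto simp: S_def)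
    then show "AE \<omega> in M. X k \<omega> \<in> S"
      using X \<open>k \<in> _\<close> by (intro AE_distrD[of "X k" M borel]) auto
  qed
  obtain s q \<eta> where s: "0 < s" and q: "0 < q" "q < 1" and \<eta>: "0 < \<eta>" and
    moment: "\<And>z. infdist z S \<le> \<eta> \<Longrightarrow> (\<integral>\<^sup>+ w. ennreal (cmod (z - w) powr - s) \<partial>\<mu>) \<le> ennreal q"
    unfolding S_def by (rule negative_moment_less_one_near_support[OF assms(1-7)]) (blast intro: that)+
  obtain R0 where R0: "S \<subseteq> cball 0 R0"
    using compact_imp_bounded[OF assms(3)] unfolding S_def bounded_iff by (force simp: subset_iff)
  define R where "R = max R0 0"
  have R: "S \<subseteq> cball 0 R" "R \<ge> 0" using R0 by (auto simp: R_def)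
  \<comment> \<open>This makes \<open>q ^ n\<close> equal to the eighth power of \<open>r n\<close>.
    The net of mesh \<open>(r n)\<^sup>2\<close> has on the order of \<open>(r n) powr - 4\<close>
    points, so the union bound leaves \<open>B * (r n) ^ 4\<close>.\<close>
  define c0 where "c0 = - ln q / 8"
  have c0: "c0 > 0" using q by (simp add: c0_def)
  have qn: "q ^ n = exp (- 8 * c0 * real n)" for n
    using q by (simp add: c0_def powr_def mult.commute flip: powr_realpow)
  define r where "r n = exp (- c0 * real n)" for n :: nat
  define E where "E n = {\<omega> \<in> space M. lemniscate (\<lambda>k. X k \<omega>) n \<subseteq> (\<Union>k\<in>{1..n}. ball (X k \<omega>) (r n))}" for n
  have E [measurable]: "E n \<in> sets M" for n
    unfolding E_def by (intro lemniscate_subset_event_measurable X) auto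
  define B where "B = 256 * (R + 1)\<^sup>2 * exp s"
  have B: "B > 0" using R by (simp add: B_def)

  have prob_E: "measure M (E n) \<ge> 1 - B * exp (- 4 * c0 * real n)"
    if n: "r n < 1" "r n \<le> \<eta> / 2" "(r n)\<^sup>2 \<le> \<eta> / 2" "real n * r n \<le> 1" for n
  proof -
    have r: "r n > 0" by (simp add: r_def)
    have "(r n)\<^sup>2 \<le> 1" using n r by (simp add: power_le_one)
    then obtain G where G: "finite G" "real (card G) \<le> (8 * (R + 1) / ((r n)\<^sup>2 / 2))\<^sup>2"
      and net: "\<And>z. cmod z \<le> R + 1 \<Longrightarrow> \<exists>g\<in>G. dist z g \<le> (r n)\<^sup>2"
      using finite_net_cball[of "(r n)\<^sup>2 / 2" "R + 1"] R r by auto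
    \<comment> \<open>The covering lemma is applied with \<open>\<eta> / 2\<close>, so it only
      consults net points within \<open>\<eta>\<close> of \<open>S\<close>, exactly where the moment
      bound is available.\<close>
    define H where "H = {g \<in> G. infdist g S \<le> \<eta>}"
    define bad where "bad g = {\<omega> \<in> space M. root_poly (\<lambda>k. X k \<omega>) n g \<noteq> 0 \<and>
       cmod (root_poly (\<lambda>k. X k \<omega>) n g) < exp 1}" for g
    have [measurable]: "(\<lambda>\<omega>. root_poly (\<lambda>k. X k \<omega>) n g) \<in> borel_measurable M" for g
      by (intro root_poly_measurable X) auto
    have [measurable]: "bad g \<in> sets M" for g
      unfolding bad_def by measurable
    have bad: "measure M (bad g) \<le> exp s * q ^ n" if "g \<in> H" for g
      using root_poly_small_probability[OF assms(8-10) s less_imp_le[OF q(1)] moment, of g n] that q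
      by (simp add: H_def bad_def emeasure_eq_measure)
    \<comment> \<open>Outside the null event that some root misses \<open>S\<close>, the
      deterministic covering can fail only if some net point in \<open>H\<close> is bad.\<close>
    have "measure M (space M - E n) \<le> measure M (\<Union>g\<in>H. bad g)"
    proof (rule finite_measure_mono_AE)
      show "AE \<omega> in M. \<omega> \<in> space M - E n \<longrightarrow> \<omega> \<in> (\<Union>g\<in>H. bad g)"
        using AE_S
      proof eventually_elim
        case (elim \<omega>)
        show ?case
        proof (rule impI, rule ccontr)
          assume \<omega>: "\<omega> \<in> space M - E n" "\<omega> \<notin> (\<Union>g\<in>H. bad g)"
          have "lemniscate (\<lambda>k. X k \<omega>) n \<subseteq> (\<Union>k\<in>{1..n}. ball (X k \<omega>) (r n))"
          proof (rule lemniscate_subset_of_net[OF R(1) _ r n net])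
            show "exp 1 \<le> cmod (root_poly (\<lambda>k. X k \<omega>) n g)"
              if "g \<in> G" "infdist g S \<le> 2 * (\<eta> / 2)" "root_poly (\<lambda>k. X k \<omega>) n g \<noteq> 0" for g
              using that \<omega> by (force simp: H_def bad_def)
          qed (use elim in auto)
          then show False using \<omega> by (simp add: E_def)
        qed
      qed
      show "(\<Union>g\<in>H. bad g) \<in> sets M"
        using G by (intro sets.finite_UN) (auto simp: H_def)
    qed
    also have "\<dots> \<le> (\<Sum>g\<in>H. measure M (bad g))"
      using G by (intro finite_measure_subadditive_finite) (auto simp: H_def)
    also have "\<dots> \<le> real (card H) * (exp s * q ^ n)"
      using sum_bounded_above[of H "\<lambda>g. measure M (bad g)"] bad by simp
    also have "\<dots> \<le> (8 * (R + 1) / ((r n)\<^sup>2 / 2))\<^sup>2 * (exp s * q ^ n)"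
      using G q card_mono[of G H] by (intro mult_right_mono) (auto simp: H_def)
    also have "\<dots> = B * exp (- 4 * c0 * real n)"
    proof -
      have "8 * (R + 1) / ((r n)\<^sup>2 / 2) = 16 * (R + 1) * exp (2 * (c0 * real n))"
        unfolding exp_double by (simp add: r_def exp_minus power_divide field_simps)
      then have "(8 * (R + 1) / ((r n)\<^sup>2 / 2))\<^sup>2 = 256 * (R + 1)\<^sup>2 * exp (4 * c0 * real n)"
        using exp_double[of "2 * (c0 * real n)"]
        by (simp only:) (simp add: power_mult_distrib mult.assoc del: distrib_left_numeral)
      then show ?thesis
        by (simp add: B_def qn mult.assoc mult.left_commute flip: exp_add)
    qed
    finally show ?thesis
      using prob_compl[OF E[of n]] by simp
  qed

  \<comment> \<open>Giving up part of the exponent \<open>4 * c0\<close> absorbs the constant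
    \<open>B\<close>, so \<open>c0\<close> also serves as the rate in the probability bound.\<close>
  have "eventually (\<lambda>n. r n < 1) sequentially" "eventually (\<lambda>n. r n \<le> \<eta> / 2) sequentially"
    "eventually (\<lambda>n. (r n)\<^sup>2 \<le> \<eta> / 2) sequentially" "eventually (\<lambda>n. real n * r n \<le> 1) sequentially"
    "eventually (\<lambda>n. B * exp (- 4 * c0 * real n) \<le> exp (- c0 * real n)) sequentially"
    unfolding r_def using c0 \<eta> B by real_asymp+
  then have "eventually (\<lambda>n. 1 - exp (- c0 * real n) \<le> measure M (E n)) sequentially"
  proof eventually_elim
    case (elim n)
    then show ?case using prob_E[of n] by linarith
  qed
  then have ow: "overwhelming_probability M E"
    unfolding overwhelming_probability_def using E c0 by (intro conjI allI exI[of _ c0])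
  \<comment> \<open>The covering implies the inradius bound for every outcome, so the event with
    both conditions is the same set and inherits its measurability.\<close>
  have E_eq: "E = (\<lambda>n. {\<omega> \<in> space M.
      lemniscate (\<lambda>k. X k \<omega>) n \<subseteq> (\<Union>k\<in>{1..n}. ball (X k \<omega>) (exp (- c0 * real n))) \<and>
      inradius (lemniscate (\<lambda>k. X k \<omega>) n) \<le> ennreal (real n * exp (- c0 * real n))})"
  proof (intro ext set_eqI)
    fix n \<omega>
    show "\<omega> \<in> E n \<longleftrightarrow> \<omega> \<in> {\<omega> \<in> space M.
      lemniscate (\<lambda>k. X k \<omega>) n \<subseteq> (\<Union>k\<in>{1..n}. ball (X k \<omega>) (exp (- c0 * real n))) \<and>
      inradius (lemniscate (\<lambda>k. X k \<omega>) n) \<le> ennreal (real n * exp (- c0 * real n))}"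
      using inradius_le_of_subset_Union[of "lemniscate (\<lambda>k. X k \<omega>) n" "\<lambda>k. X k \<omega>" "exp (- c0 * real n)" n,
        OF _ exp_ge_zero]
      unfolding E_def r_def mem_Collect_eq by iprover
  qed
  show ?thesis
    using ow c0 unfolding E_eq by (intro exI[of _ c0] conjI)
qed

end
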